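(* Let $n\ge r\ge 1$ be integers. The minimum value of the penalty function $\Psi\mapsto R_{1,2}(\mathrm{Range}(\Psi))$ over the space $\mathbb{R}_*^{n\times r}$ of real $n\times r$ matrices with linearly independent columns is zero. This value is attained by $\Psi\in\mathbb{R}_*^{n\times r}$ if and only if $\Psi$ has precisely $r$ rows with nonzero entries (that is, exactly $r$ of the $n$ rows of $\Psi$ are not identically zero).
   Context: For a real $n\times r$ matrix $M$ with rows $\mathrm{row}_1(M),\dots,\mathrm{row}_n(M)$, let $\|M\|_{1,2}=\sum_{i=1}^n\|\mathrm{row}_i(M)\|_2$ be the sum of the Euclidean norms of its rows. For $\Psi\in\mathbb{R}^{n\times r}$ with linearly independent columns, let $U\in\mathbb{R}^{n\times r}$ be any matrix with orthonormal columns spanning the column space $\mathrm{Range}(\Psi)$, and define $R_{1,2}(\mathrm{Range}(\Psi))=\|U\|_{1,2}-r$. This does not depend on the choice of $U$, since $\|\cdot\|_{1,2}$ is invariant under multiplication on the right by $r\times r$ orthogonal matrices. *)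

theory Defs
  imports "HOL-Analysis.Analysis"
begin

text \<open>A real \<open>n \<times> r\<close> matrix has type \<open>real ^ 'r ^ 'n\<close>, with \<open>n = CARD('n)\<close> and \<open>r = CARD('r)\<close>,
  and the range of \<open>M\<close> is \<open>range ((*v) M)\<close>.\<close>

definition norm12 :: "real ^ 'r ^ 'n \<Rightarrow> real" where
  "norm12 M = (\<Sum>i\<in>UNIV. norm (row i M))"

text \<open>Independence of the columns as a family: independence of the set \<open>columns M\<close> would not rule
  out repeated columns.\<close>

definition lin_indep_columns :: "real ^ 'r ^ 'n \<Rightarrow> bool" where
  "lin_indep_columns M \<longleftrightarrow>
     (\<forall>c. (\<Sum>j\<in>UNIV. c j *s column j M) = 0 \<longrightarrow> (\<forall>j. c j = 0))"

definition orthonormal_columns :: "real ^ 'r ^ 'n \<Rightarrow> bool" where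
  "orthonormal_columns U \<longleftrightarrow>
     (\<forall>j. norm (column j U) = 1) \<and>
     (\<forall>j k. j \<noteq> k \<longrightarrow> orthogonal (column j U) (column k U))"

text \<open>\<open>R12\<close> is a function of a subspace \<open>V\<close> of dimension \<open>r\<close>; the first argument only supplies the
  index type for the columns of \<open>U\<close>. For \<open>V = range ((*v) \<Psi>)\<close> with \<open>lin_indep_columns \<Psi>\<close>, the
  lemmas \<open>ex_orthonormal_columns\<close> and \<open>R12_eq\<close> below show that a suitable \<open>U\<close> exists and that the
  value does not depend on its choice.\<close>

definition R12 :: "'r::finite itself \<Rightarrow> (real ^ 'n) set \<Rightarrow> real" where
  "R12 _ V =
     norm12 (SOME U :: real ^ 'r ^ 'n. orthonormal_columns U \<and> range ((*v) U) = V)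
       - real CARD('r)"

lemma orthonormal_columns_iff:
  "orthonormal_columns U \<longleftrightarrow> transpose U ** U = mat 1"
  by (auto simp: orthonormal_columns_def matrix_mult_transpose_dot_column vec_eq_iff mat_def
      norm_eq_1 orthogonal_def)

lemma range_mult_eq_span_columns:
  fixes M :: "real ^ 'r ^ 'n"
  shows "range ((*v) M) = span (columns M)"
proof
  show "range ((*v) M) \<subseteq> span (columns M)"
    using matrix_vector_mult_in_columnspace by blast
  have "columns M \<subseteq> range ((*v) M)"
    by (auto simp: columns_image_basis)
  moreover have "subspace (range ((*v) M))"
    by (intro subspace_UNIV linear_subspace_image matrix_vector_mul_linear)
  ultimately show "span (columns M) \<subseteq> range ((*v) M)"
    by (rule span_minimal)
qed

lemma norm12_mult_orthogonal:
  fixes U :: "real ^ 'r ^ 'n" and Q :: "real ^ 'r ^ 'r"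
  assumes "orthogonal_matrix Q"
  shows "norm12 (U ** Q) = norm12 U"
proof -
  have "norm (row i (U ** Q)) = norm (row i U)" for i
  proof -
    have "row i (U ** Q) = transpose Q *v row i U"
      by (simp add: row_def matrix_matrix_mult_def matrix_vector_mult_def transpose_def
          vec_eq_iff mult.commute)
    moreover have "orthogonal_transformation ((*v) (transpose Q))"
      using assms by (simp add: orthogonal_transformation_matrix)
    ultimately show ?thesis
      by (metis orthogonal_transformation_norm)
  qed
  then show ?thesis by (simp add: norm12_def)
qed

lemma norm12_cong_range:
  fixes U W :: "real ^ 'r ^ 'n"
  assumes U: "orthonormal_columns U" and W: "orthonormal_columns W"
    and eq: "range ((*v) W) = range ((*v) U)"
  shows "norm12 W = norm12 U"
proof -
  define Q where "Q = transpose U ** W"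
  have "U ** Q = W"
  proof (subst matrix_eq, rule allI)
    fix x
    obtain y where y: "W *v x = U *v y" using eq by blast
    have "(U ** Q) *v x = U *v (transpose U *v (W *v x))"
      by (simp add: Q_def matrix_vector_mul_assoc matrix_mul_assoc)
    also have "\<dots> = U *v ((transpose U ** U) *v y)"
      by (simp add: y matrix_vector_mul_assoc)
    also have "\<dots> = W *v x"
      using U by (simp add: orthonormal_columns_iff y)
    finally show "(U ** Q) *v x = W *v x" .
  qed
  moreover have "orthogonal_matrix Q"
  proof -
    have "transpose Q ** Q = transpose W ** (U ** Q)"
      by (simp add: Q_def matrix_transpose_mul matrix_mul_assoc)
    also have "\<dots> = mat 1"
      using W \<open>U ** Q = W\<close> by (simp add: orthonormal_columns_iff)
    finally show ?thesis by (simp add: orthogonal_matrix)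
  qed
  ultimately show ?thesis using norm12_mult_orthogonal[of Q U] by simp
qed

lemma R12_eq:
  fixes U :: "real ^ 'r ^ 'n"
  assumes "orthonormal_columns U" and "range ((*v) U) = V"
  shows "R12 TYPE('r) V = norm12 U - real CARD('r)"
proof -
  let ?P = "\<lambda>W :: real ^ 'r ^ 'n. orthonormal_columns W \<and> range ((*v) W) = V"
  have P: "?P (SOME W. ?P W)"
    by (rule someI[of ?P U]) (use assms in simp)
  have "norm12 (SOME W. ?P W) = norm12 U"
    by (rule norm12_cong_range) (use P assms in auto)
  then show ?thesis
    by (simp add: R12_def)
qed

lemma ex_orthonormal_columns:
  fixes \<Psi> :: "real ^ 'r ^ 'n"
  assumes "lin_indep_columns \<Psi>"
  shows "\<exists>U :: real ^ 'r ^ 'n. orthonormal_columns U \<and> range ((*v) U) = range ((*v) \<Psi>)"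
proof -
  let ?S = "range ((*v) \<Psi>)"
  have "inj ((*v) \<Psi>)"
    using assms matrix_left_invertible_independent_columns[of \<Psi>]
    by (simp add: lin_indep_columns_def matrix_left_invertible_injective)
  then have dim: "dim ?S = CARD('r)"
    using full_rank_injective[of \<Psi>] rank_dim_range[of \<Psi>] by simp
  have "subspace ?S"
    by (intro subspace_UNIV linear_subspace_image matrix_vector_mul_linear)
  then obtain B where B: "B \<subseteq> ?S" "pairwise orthogonal B" "\<And>x. x \<in> B \<Longrightarrow> norm x = 1"
    "independent B" "card B = dim ?S" "span B = ?S"
    using orthonormal_basis_subspace by blast
  then have "finite B" using independent_imp_finite by blast
  then obtain f where f: "bij_betw f (UNIV :: 'r set) B"
    using B(5) dim finite_same_card_bij[of "UNIV :: 'r set" B] by auto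
  define U :: "real ^ 'r ^ 'n" where "U = (\<chi> i j. f j $ i)"
  have col: "column j U = f j" for j
    by (simp add: U_def column_def vec_eq_iff)
  have "columns U = B"
    using f by (simp add: columns_def col bij_betw_def full_SetCompr_eq)
  then have "range ((*v) U) = ?S"
    using B(6) by (simp add: range_mult_eq_span_columns)
  moreover have "orthonormal_columns U"
    unfolding orthonormal_columns_def col
  proof (intro conjI allI impI)
    fix j
    show "norm (f j) = 1" using f B(3) by (auto simp: bij_betw_def)
  next
    fix j k :: 'r
    assume "j \<noteq> k"
    then have "f j \<noteq> f k" using f by (auto simp: bij_betw_def inj_on_def)
    moreover have "f j \<in> B" "f k \<in> B" using f by (auto simp: bij_betw_def)
    ultimately show "orthogonal (f j) (f k)" using B(2) by (auto simp: pairwise_def)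
  qed
  ultimately show ?thesis by blast
qed

end

theory Submission
  imports Defs
begin

text \<open>Let \<open>U\<close> have orthonormal columns and let \<open>u\<^sub>i\<close> be the norm of its \<open>i\<close>-th row. The
  entries of \<open>U\<close> have square sum \<open>r\<close>, so \<open>\<Sum>\<^sub>i u\<^sub>i\<^sup>2 = r\<close>; and since \<open>U\<close> acts as an isometry,
  \<open>u\<^sub>i\<^sup>2 \<le> u\<^sub>i\<close> (lemma \<open>norm_row_power2_le\<close>), that is, \<open>u\<^sub>i \<le> 1\<close>. Summing these inequalities
  gives
  \<open>r \<le> norm12 U \<le> card {i. row i U \<noteq> 0}\<close>.
  The left inequality says that the penalty is nonnegative. If \<open>U\<close> has exactly \<open>r\<close> nonzero rows,
  the two bounds coincide and the penalty vanishes. If the penalty vanishes, then every inequality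
  \<open>u\<^sub>i\<^sup>2 \<le> u\<^sub>i\<close> is an equality, so each \<open>u\<^sub>i\<close> is \<open>0\<close> or \<open>1\<close>, and their sum \<open>r\<close> counts the nonzero
  rows.

  The \<open>i\<close>-th row of a matrix vanishes iff the \<open>i\<close>-th coordinate vanishes on its range, so \<open>\<Psi>\<close> and
  an orthonormal basis matrix \<open>U\<close> of its range have the same nonzero rows, and the criterion
  carries over to \<open>\<Psi>\<close>. The minimum is attained by the matrix of a coordinate embedding.\<close>

lemma lin_indep_columns_if_orthonormal_columns:
  fixes U :: "real ^ 'r ^ 'n"
  assumes "orthonormal_columns U"
  shows "lin_indep_columns U"
  using assms matrix_left_invertible_independent_columns[of U]
  unfolding orthonormal_columns_iff lin_indep_columns_def by blast

lemma norm_mult_orthonormal_columns: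
  fixes U :: "real ^ 'r ^ 'n"
  assumes "orthonormal_columns U"
  shows "norm (U *v x) = norm x"
proof -
  have "(U *v x) \<bullet> (U *v x) = (transpose U *v (U *v x)) \<bullet> x"
    by (simp only: transpose_matrix_vector dot_lmul_matrix)
  also have "\<dots> = x \<bullet> x"
    using assms by (simp add: matrix_vector_mul_assoc orthonormal_columns_iff
        del: transpose_matrix_vector)
  finally show ?thesis by (simp add: norm_eq)
qed

text \<open>The \<open>i\<close>-th coordinate of \<open>U x\<close> is the inner product of the \<open>i\<close>-th row with \<open>x\<close>. Taking for
  \<open>x\<close> the row itself makes this coordinate \<open>\<parallel>x\<parallel>\<^sup>2\<close>, and it is at most \<open>\<parallel>U x\<parallel> = \<parallel>x\<parallel>\<close>.\<close>

lemma norm_row_power2_le: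
  fixes U :: "real ^ 'r ^ 'n"
  assumes "orthonormal_columns U"
  shows "(norm (row i U))\<^sup>2 \<le> norm (row i U)"
proof -
  have "(norm (row i U))\<^sup>2 = (U *v row i U) $ i"
    by (simp add: power2_norm_eq_inner matrix_vector_mul_component row_def)
  also have "\<dots> \<le> norm (U *v row i U)"
    using component_le_norm_cart[of "U *v row i U" i] by linarith
  finally show ?thesis
    by (simp add: norm_mult_orthonormal_columns[OF assms])
qed

lemma sum_norm_row_power2:
  fixes U :: "real ^ 'r ^ 'n"
  assumes "orthonormal_columns U"
  shows "(\<Sum>i\<in>UNIV. (norm (row i U))\<^sup>2) = real CARD('r)"
proof -
  have "(\<Sum>i\<in>UNIV. (norm (row i U))\<^sup>2) = (\<Sum>i\<in>UNIV. \<Sum>j\<in>UNIV. U $ i $ j * U $ i $ j)"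
    by (simp add: power2_norm_eq_inner inner_vec_def row_def)
  also have "\<dots> = (\<Sum>j\<in>UNIV. \<Sum>i\<in>UNIV. U $ i $ j * U $ i $ j)"
    by (rule sum.swap)
  also have "\<dots> = (\<Sum>j\<in>UNIV. (norm (column j U))\<^sup>2)"
    by (simp add: power2_norm_eq_inner inner_vec_def column_def)
  also have "\<dots> = real CARD('r)"
    using assms by (simp add: orthonormal_columns_def)
  finally show ?thesis .
qed

lemma norm12_ge_card_columns:
  fixes U :: "real ^ 'r ^ 'n"
  assumes "orthonormal_columns U"
  shows "real CARD('r) \<le> norm12 U"
  unfolding sum_norm_row_power2[OF assms, symmetric] norm12_def
  by (intro sum_mono norm_row_power2_le assms)

lemma sum_of_bool_row_nonzero:
  fixes M :: "real ^ 'r ^ 'n"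
  shows "(\<Sum>i\<in>UNIV. of_bool (row i M \<noteq> 0)) = real (card {i. row i M \<noteq> 0})"
  by simp

lemma norm12_le_card_nonzero_rows:
  fixes U :: "real ^ 'r ^ 'n"
  assumes "orthonormal_columns U"
  shows "norm12 U \<le> real (card {i. row i U \<noteq> 0})"
proof -
  have "norm (row i U) \<le> of_bool (row i U \<noteq> 0)" for i
    using norm_row_power2_le[OF assms, of i] by (auto simp: power2_eq_square)
  then show ?thesis
    unfolding norm12_def sum_of_bool_row_nonzero[symmetric] by (intro sum_mono)
qed

lemma norm12_eq_card_columns_iff:
  fixes U :: "real ^ 'r ^ 'n"
  assumes U: "orthonormal_columns U"
  shows "norm12 U = real CARD('r) \<longleftrightarrow> card {i. row i U \<noteq> 0} = CARD('r)"
proof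
  assume "card {i. row i U \<noteq> 0} = CARD('r)"
  then show "norm12 U = real CARD('r)"
    using norm12_ge_card_columns[OF U] norm12_le_card_nonzero_rows[OF U] by simp
next
  assume eq: "norm12 U = real CARD('r)"
  \<comment> \<open>The gaps \<open>u\<^sub>i - u\<^sub>i\<^sup>2\<close> are nonnegative and add up to the penalty.\<close>
  have "(\<Sum>i\<in>UNIV. norm (row i U) - (norm (row i U))\<^sup>2) = 0"
    using eq by (simp add: sum_subtractf sum_norm_row_power2[OF U] norm12_def)
  then have "norm (row i U) - (norm (row i U))\<^sup>2 = 0" for i
    using norm_row_power2_le[OF U] by (subst (asm) sum_nonneg_eq_0_iff) auto
  then have "norm (row i U) = of_bool (row i U \<noteq> 0)" for i
    by (auto simp: power2_eq_square)
  then have "norm12 U = real (card {i. row i U \<noteq> 0})"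
    unfolding norm12_def sum_of_bool_row_nonzero[symmetric] by (intro sum.cong refl)
  then show "card {i. row i U \<noteq> 0} = CARD('r)"
    using eq by simp
qed

lemma row_eq_0_iff_range:
  fixes M :: "real ^ 'r ^ 'n"
  shows "row i M = 0 \<longleftrightarrow> (\<forall>v \<in> range ((*v) M). v $ i = 0)"
proof -
  have "(M *v x) $ i = row i M \<bullet> x" for x
    by (simp add: matrix_vector_mul_component row_def)
  then show ?thesis
    using inner_eq_zero_iff[of "row i M"] by fastforce
qed

lemma R12_nonneg_and_eq_0_iff:
  fixes \<Psi> :: "real ^ 'r ^ 'n"
  assumes "lin_indep_columns \<Psi>"
  shows "R12 TYPE('r) (range ((*v) \<Psi>)) \<ge> 0"
    and "R12 TYPE('r) (range ((*v) \<Psi>)) = 0 \<longleftrightarrow> card {i. row i \<Psi> \<noteq> 0} = CARD('r)"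
proof -
  obtain U :: "real ^ 'r ^ 'n" where U: "orthonormal_columns U"
    and range: "range ((*v) U) = range ((*v) \<Psi>)"
    using ex_orthonormal_columns[OF assms] by blast
  have R12: "R12 TYPE('r) (range ((*v) \<Psi>)) = norm12 U - real CARD('r)"
    by (rule R12_eq[OF U range])
  show "R12 TYPE('r) (range ((*v) \<Psi>)) \<ge> 0"
    using norm12_ge_card_columns[OF U] by (simp add: R12)
  have "{i. row i U \<noteq> 0} = {i. row i \<Psi> \<noteq> 0}"
    by (simp only: row_eq_0_iff_range range)
  then show "R12 TYPE('r) (range ((*v) \<Psi>)) = 0 \<longleftrightarrow> card {i. row i \<Psi> \<noteq> 0} = CARD('r)"
    using norm12_eq_card_columns_iff[OF U] by (simp add: R12)
qed

text \<open>The matrix of the embedding that sends the \<open>j\<close>-th basis vector to the \<open>f j\<close>-th one, for an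
  injection \<open>f\<close> of the column indices into the row indices: its nonzero rows are those indexed by
  the image of \<open>f\<close>.\<close>

lemma ex_orthonormal_columns_card_nonzero_rows:
  assumes "CARD('r::finite) \<le> CARD('n::finite)"
  shows "\<exists>U :: real ^ 'r ^ 'n. orthonormal_columns U \<and> card {i. row i U \<noteq> 0} = CARD('r)"
proof -
  obtain f :: "'r \<Rightarrow> 'n" where f: "inj f"
    using card_le_inj[of "UNIV :: 'r set" "UNIV :: 'n set"] assms by auto
  define U :: "real ^ 'r ^ 'n" where "U = (\<chi> i j. of_bool (i = f j))"
  have col: "column j U = axis (f j) 1" for j
    by (simp add: U_def column_def axis_def vec_eq_iff)
  have "orthonormal_columns U"
    using f by (auto simp: orthonormal_columns_def col orthogonal_def inner_axis_axis inj_eq)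
  moreover have "{i. row i U \<noteq> 0} = range f"
    by (auto simp: U_def row_def vec_eq_iff)
  ultimately show ?thesis
    using f card_image[of f UNIV] by auto
qed

theorem theorem2:
  assumes "CARD('r::finite) \<le> CARD('n::finite)"
  shows "(\<exists>\<Psi> :: real ^ 'r ^ 'n. lin_indep_columns \<Psi> \<and> R12 TYPE('r) (range ((*v) \<Psi>)) = 0)
    \<and> (\<forall>\<Psi> :: real ^ 'r ^ 'n. lin_indep_columns \<Psi> \<longrightarrow> R12 TYPE('r) (range ((*v) \<Psi>)) \<ge> 0)
    \<and> (\<forall>\<Psi> :: real ^ 'r ^ 'n. lin_indep_columns \<Psi> \<longrightarrow>
         (R12 TYPE('r) (range ((*v) \<Psi>)) = 0 \<longleftrightarrow> card {i. row i \<Psi> \<noteq> 0} = CARD('r)))"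
  using ex_orthonormal_columns_card_nonzero_rows[OF assms]
    lin_indep_columns_if_orthonormal_columns R12_nonneg_and_eq_0_iff
  by metis

end
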